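(* Let $x_1,\dots,x_n$ be random vectors in $\mathbb{R}^d$, let $\delta\in[0,0.1]$, $\rho\ge 0$, and suppose a good subset $\mathcal G\subseteq[n]$ with $|\mathcal G|\ge(1-\delta)n$ is such that $\{x_i\}_{i\in\mathcal G}$ are independent with $\mathbb{E}\|x_i-x_j\|^2\le\rho^2$ for any fixed $i,j\in\mathcal G$ (the other vectors are arbitrary). Let $\bar x:=\frac1{|\mathcal G|}\sum_{j\in\mathcal G}x_j$ and let $v_0\in\mathbb{R}^d$ be any starting point. 1. If $\delta\rho^2>0$ and $\mathbb{E}\|v_0-\bar x\|^2\le B^2$ with $B>0$, then for a suitable choice of clipping radii depending only on $n,\delta,\rho,B$, running centered clipping from $v_0$ for $l=\lceil 100\log(3B^2/(\delta\rho^2))\rceil$ steps (no steps if this is negative) gives an output $\hat x$ with $\mathbb{E}\|\hat x-\bar x\|^2\le c\,\delta\rho^2$ for $c=4000$; that is, it is a $(\delta_{\max},c)$-robust aggregator with $\delta_{\max}=0.1$ and $c=4000$. 2. If $\mathbb{E}\|v_0-\bar x\|^2\le\rho^2$, then for a suitable clipping radius depending only on $n,\delta,\rho$, a single step of centered clipping from $v_0$ gives an output $\hat x$ with $\mathbb{E}\|\hat x-\bar x\|^2\le 4000\,\delta\rho^2$; that is, a single step is a $(\delta_{\max},c)$-robust aggregator with the same constants.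
   Context: **Centered clipping.** Given vectors $x_1,\dots,x_n\in\mathbb{R}^d$, a starting point $v_0$ and clipping radii $\tau_l\in(0,\infty]$, iterate for $l\ge0$ $$v_{l+1}=v_l+\frac1n\sum_{i=1}^n (x_i-v_l)\min\Big(1,\frac{\tau_l}{\|x_i-v_l\|}\Big),$$ where a term with $x_i=v_l$ is $0$ and $\tau_l=\infty$ means no clipping. The output after $l$ steps is $v_l$. **$(\delta_{\max},c)$-robust aggregator.** A rule which, for every $\delta\le\delta_{\max}\le0.5$ and all random vectors $x_1,\dots,x_n$ having a good subset $\mathcal G$, $|\mathcal G|\ge(1-\delta)n$, of independent vectors with $\mathbb{E}\|x_i-x_j\|^2\le\rho^2$ for any fixed $i,j\in\mathcal G$, outputs $\hat x$ with $\mathbb{E}\|\hat x-\bar x\|^2\le c\,\delta\rho^2$, where $\bar x$ is the average of the good vectors.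
   Formalization: In part 2, when ρ=0 and δ>0, clipping radius 0 is also allowed, because with a positive radius the claim fails there once δn≥1 (a bad vector moves the output while the bound is 0); the radii are chosen per carrier type of the sample space, which the joint law makes immaterial. *)

theory Defs
  imports "HOL-Probability.Probability"
begin

text \<open>
  The dimension \<open>d\<close> is a term rather than a type: clipping radii have to be chosen uniformly
  in \<open>d\<close>, and a quantifier over dimensions cannot occur below an existential one if the
  dimension is a type. Points of \<open>d\<close>-space are the extensional functions on \<open>{..<d}\<close>, which is
  the carrier of the product measure below; its sigma-algebra is the Borel one.
\<close>

definition rspace :: "nat \<Rightarrow> (nat \<Rightarrow> real) measure" where
  "rspace d = Pi\<^sub>M {..<d} (\<lambda>_. borel)"

definition vdist :: "nat \<Rightarrow> (nat \<Rightarrow> real) \<Rightarrow> (nat \<Rightarrow> real) \<Rightarrow> real" where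
  "vdist d u v = L2_set (\<lambda>k. u k - v k) {..<d}"

text \<open>
  The mean squared distance is a nonnegative integral with values in \<open>[0, \<infinity>]\<close>, so an upper bound
  on it includes integrability (the Bochner integral of a non-integrable function would be 0).
\<close>

definition msd ::
  "'w measure \<Rightarrow> nat \<Rightarrow> ('w \<Rightarrow> nat \<Rightarrow> real) \<Rightarrow> ('w \<Rightarrow> nat \<Rightarrow> real) \<Rightarrow> ennreal" where
  "msd M d X Y = (\<integral>\<^sup>+ \<omega>. ennreal ((vdist d (X \<omega>) (Y \<omega>))\<^sup>2) \<partial>M)"

text \<open>
  At \<open>r = 0\<close> the value of the factor is irrelevant, as it multiplies the zero vector;
  \<open>\<tau> = \<infinity>\<close> gives the factor 1.
\<close>

definition clip_factor :: "ereal \<Rightarrow> real \<Rightarrow> real" where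
  "clip_factor \<tau> r = real_of_ereal (min 1 (\<tau> / ereal r))"

definition clip_step ::
  "nat \<Rightarrow> nat \<Rightarrow> ereal \<Rightarrow> (nat \<Rightarrow> nat \<Rightarrow> real) \<Rightarrow> (nat \<Rightarrow> real) \<Rightarrow> (nat \<Rightarrow> real)" where
  "clip_step d n \<tau> x v =
     (\<lambda>k\<in>{..<d}. v k + 1 / real n * (\<Sum>i=1..n. (x i k - v k) * clip_factor \<tau> (vdist d (x i) v)))"

primrec centered_clipping ::
  "nat \<Rightarrow> nat \<Rightarrow> (nat \<Rightarrow> ereal) \<Rightarrow> (nat \<Rightarrow> real) \<Rightarrow> (nat \<Rightarrow> nat \<Rightarrow> real) \<Rightarrow> nat \<Rightarrow> (nat \<Rightarrow> real)" where
  "centered_clipping d n \<tau> v0 x 0 = v0"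
| "centered_clipping d n \<tau> v0 x (Suc l) = clip_step d n (\<tau> l) x (centered_clipping d n \<tau> v0 x l)"

definition good_mean :: "nat \<Rightarrow> nat set \<Rightarrow> (nat \<Rightarrow> nat \<Rightarrow> real) \<Rightarrow> (nat \<Rightarrow> real)" where
  "good_mean d G x = (\<lambda>k\<in>{..<d}. 1 / real (card G) * (\<Sum>j\<in>G. x j k))"

text \<open>
  Vectors with index outside \<open>G\<close> are only required to be measurable; they may depend on all the
  others in any way.
\<close>

definition corrupted_sample ::
  "'w measure \<Rightarrow> nat \<Rightarrow> nat \<Rightarrow> real \<Rightarrow> real \<Rightarrow> nat set \<Rightarrow> (nat \<Rightarrow> 'w \<Rightarrow> nat \<Rightarrow> real) \<Rightarrow> bool" where
  "corrupted_sample M d n \<delta> \<rho> G x \<longleftrightarrow>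
     prob_space M \<and>
     (\<forall>i\<in>{1..n}. x i \<in> M \<rightarrow>\<^sub>M rspace d) \<and>
     G \<subseteq> {1..n} \<and> (1 - \<delta>) * real n \<le> real (card G) \<and>
     prob_space.indep_vars M (\<lambda>_. rspace d) x G \<and>
     (\<forall>i\<in>G. \<forall>j\<in>G. msd M d (x i) (x j) \<le> ennreal (\<rho>\<^sup>2))"

end

theory Submission
  imports Defs
begin

text \<open>
  With \<open>n \<delta> < 1\<close> there are no bad vectors, and one step without clipping lands on the mean of
  the good ones. Otherwise let \<open>T = \<rho> / sqrt \<delta>\<close>, let the radius be halved at every step so that
  the last one is \<open>2 T\<close>, and let the scale \<open>r\<close> be half of the current radius.
  The iterates depend on the sample, so every step is estimated pathwise. If the error is at most
  \<open>r\<close>, a good vector \<open>x i\<close> with mean \<open>\<mu> i\<close> is shortened by at most the excess of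
  \<open>|x i - \<mu> i|\<close> over \<open>T / 2\<close>, plus the deviation \<open>N\<close> of the good mean from its expectation.
  With \<open>S\<close> the sum of these excesses divided by \<open>n\<close>, the new error is at most
  \<open>N + S + 3 \<delta> r\<close>, and thus at most \<open>r / 2\<close> unless the noise \<open>N + S\<close> is of the order of \<open>r\<close>.
  In that case the remaining steps move the point by at most \<open>4 r\<close> in total, which the noise
  dominates. Neither \<open>N\<close> nor \<open>S\<close> involves the iterates, and both are averages of independent
  variables, with second moments of order \<open>\<delta> \<rho>\<^sup>2\<close>.
\<close>

section \<open>Clipping steps\<close>

lemma vdist_nonneg [simp]: "0 \<le> vdist d u v"
  by (simp add: vdist_def)

lemma vdist_commute: "vdist d u v = vdist d v u"
  unfolding vdist_def L2_set_def by (simp add: power2_commute)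

lemma vdist_triangle: "vdist d u w \<le> vdist d u v + vdist d v w"
  using L2_set_triangle_ineq[of "\<lambda>k. u k - v k" "\<lambda>k. v k - w k" "{..<d}"]
  by (simp add: vdist_def)

lemma vdist_sq: "(vdist d u v)\<^sup>2 = (\<Sum>k<d. (u k - v k)\<^sup>2)"
  by (simp add: vdist_def L2_set_def sum_nonneg)

lemma vdist_cong:
  "\<lbrakk>\<And>k. k < d \<Longrightarrow> u k = u' k; \<And>k. k < d \<Longrightarrow> v k = v' k\<rbrakk> \<Longrightarrow> vdist d u v = vdist d u' v'"
  unfolding vdist_def by (intro L2_set_cong) auto

lemma L2_set_sum:
  "L2_set (\<lambda>k. \<Sum>i\<in>I. f i k) K \<le> (\<Sum>i\<in>I. L2_set (f i) K)"
proof (induction I rule: infinite_finite_induct)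
  case (insert i I)
  have "L2_set (\<lambda>k. \<Sum>i\<in>insert i I. f i k) K = L2_set (\<lambda>k. f i k + (\<Sum>i\<in>I. f i k)) K"
    using insert.hyps by simp
  also have "\<dots> \<le> L2_set (f i) K + L2_set (\<lambda>k. \<Sum>i\<in>I. f i k) K"
    by (rule L2_set_triangle_ineq)
  finally show ?case using insert by simp
qed (auto simp: L2_set_def)

lemma L2_set_scale: "L2_set (\<lambda>k. c * f k) K = \<bar>c\<bar> * L2_set f K"
  by (simp add: L2_set_def power_mult_distrib real_sqrt_mult flip: sum_distrib_left)

section \<open>The clip factor and the effect of one step\<close>

lemma clip_factor_infinity [simp]: "0 \<le> r \<Longrightarrow> clip_factor \<infinity> r = 1"
  by (cases "r = 0") (auto simp: clip_factor_def min_def)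

lemma clip_factor_real:
  assumes "0 < t" "0 \<le> r"
  shows "clip_factor (ereal t) r = (if r \<le> t then 1 else t / r)"
proof (cases "r = 0")
  case True
  then show ?thesis using assms by (auto simp: clip_factor_def divide_ereal_def)
next
  case False
  then show ?thesis using assms by (auto simp: clip_factor_def min_def field_simps)
qed

text \<open>For a vector of length \<open>r\<close>, these are the length that clipping removes and
  the length that it leaves.\<close>

lemma clip_factor_residual:
  assumes "0 < t" "0 \<le> r"
  shows "r * \<bar>clip_factor (ereal t) r - 1\<bar> = max 0 (r - t)"
    and "r * \<bar>clip_factor (ereal t) r\<bar> \<le> t"
proof -
  have "r * \<bar>t / r - 1\<bar> = r - t" if "t < r"
    using that assms by (simp add: abs_if field_simps)
  then show "r * \<bar>clip_factor (ereal t) r - 1\<bar> = max 0 (r - t)"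
    using assms by (simp add: clip_factor_real)
  show "r * \<bar>clip_factor (ereal t) r\<bar> \<le> t"
    using assms by (auto simp: clip_factor_real)
qed

text \<open>A step is an average of \<open>n\<close> clipped vectors. The bound holds from any
  point, so it limits the movement even when the error is out of control.\<close>

lemma vdist_clip_step_self:
  assumes "0 < t" "1 \<le> n"
  shows "vdist d (clip_step d n (ereal t) x v) v \<le> t"
proof -
  let ?c = "\<lambda>i. clip_factor (ereal t) (vdist d (x i) v)"
  have "vdist d (clip_step d n (ereal t) x v) v
      = L2_set (\<lambda>k. 1 / real n * (\<Sum>i=1..n. ?c i * (x i k - v k))) {..<d}"
    unfolding vdist_def clip_step_def by (intro L2_set_cong) (auto simp: mult.commute)
  also have "\<dots> \<le> 1 / real n * (\<Sum>i=1..n. L2_set (\<lambda>k. ?c i * (x i k - v k)) {..<d})"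
    unfolding L2_set_scale[of "1 / real n"] by (simp add: divide_right_mono L2_set_sum)
  also have "\<dots> = 1 / real n * (\<Sum>i=1..n. vdist d (x i) v * \<bar>?c i\<bar>)"
    unfolding L2_set_scale vdist_def by (simp add: mult.commute)
  also have "\<dots> \<le> 1 / real n * (\<Sum>i=1..n. t)"
    using clip_factor_residual(2)[OF assms(1)] by (intro mult_left_mono sum_mono) auto
  also have "\<dots> = t" using assms by simp
  finally show ?thesis .
qed

lemma good_mean_eq:
  "\<lbrakk>finite G; G \<noteq> {}; k < d\<rbrakk> \<Longrightarrow> (\<Sum>i\<in>G. x i k) = real (card G) * good_mean d G x k"
  by (simp add: good_mean_def)

text \<open>
  Clipping a good vector costs the excess of its distance over the radius; a clipped bad vector
  is within the radius of the current point.
\<close>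

lemma vdist_clip_step_good_mean:
  fixes d :: nat and x :: "nat \<Rightarrow> nat \<Rightarrow> real"
  assumes "0 < t" "1 \<le> n" "G \<subseteq> {1..n}" "G \<noteq> {}"
  defines "m \<equiv> good_mean d G x"
  shows "vdist d (clip_step d n (ereal t) x v) m
    \<le> 1 / real n * ((\<Sum>i\<in>G. max 0 (vdist d (x i) v - t)) + (real n - real (card G)) * (vdist d v m + t))"
proof -
  let ?c = "\<lambda>i. clip_factor (ereal t) (vdist d (x i) v)"
  let ?H = "{1..n} - G"
  have fin: "finite G" using assms(3) finite_subset by auto
  have cH: "real (card ?H) = real n - real (card G)"
    using assms(3) fin card_mono[OF _ assms(3)] by (simp add: card_Diff_subset of_nat_diff)
  \<comment> \<open>The sum of \<open>x i - v\<close> over \<open>G\<close> is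
    \<open>card G * (m - v)\<close>. The good terms thus reduce to their clipping residuals, and
    each bad index takes one of the remaining \<open>n - card G\<close> copies of
    \<open>v - m\<close>.\<close>
  define f where "f i k = (if i \<in> G then (?c i - 1) * (x i k - v k)
                           else ?c i * (x i k - v k) + (v k - m k))" for i k
  have "vdist d (clip_step d n (ereal t) x v) m = L2_set (\<lambda>k. 1 / real n * (\<Sum>i=1..n. f i k)) {..<d}"
    unfolding vdist_def
  proof (intro L2_set_cong)
    fix k assume "k \<in> {..<d}"
    then have k: "k < d" by simp
    have split: "(\<Sum>i=1..n. g i) = (\<Sum>i\<in>G. g i) + (\<Sum>i\<in>?H. g i)" for g :: "nat \<Rightarrow> real"
      using sum.subset_diff[OF assms(3), of g] by simp
    have "(\<Sum>i\<in>G. f i k) = (\<Sum>i\<in>G. (x i k - v k) * ?c i) - (\<Sum>i\<in>G. x i k - v k)"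
      by (simp add: f_def algebra_simps flip: sum_subtractf)
    also have "(\<Sum>i\<in>G. x i k - v k) = real (card G) * (m k - v k)"
      using good_mean_eq[OF fin assms(4) k, of x] by (simp add: sum_subtractf m_def algebra_simps)
    finally have 1: "(\<Sum>i\<in>G. f i k) = (\<Sum>i\<in>G. (x i k - v k) * ?c i) - real (card G) * (m k - v k)" .
    have "(\<Sum>i\<in>?H. f i k) = (\<Sum>i\<in>?H. (x i k - v k) * ?c i + (v k - m k))"
      by (intro sum.cong) (auto simp: f_def)
    also have "\<dots> = (\<Sum>i\<in>?H. (x i k - v k) * ?c i) + (real n - real (card G)) * (v k - m k)"
      using cH by (simp add: sum.distrib)
    finally have 2: "(\<Sum>i\<in>?H. f i k)
      = (\<Sum>i\<in>?H. (x i k - v k) * ?c i) + (real n - real (card G)) * (v k - m k)" .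
    show "clip_step d n (ereal t) x v k - m k = 1 / real n * (\<Sum>i=1..n. f i k)"
      unfolding clip_step_def split 1 2 using k assms(2) by (simp add: field_simps)
  qed simp
  also have "\<dots> \<le> 1 / real n * (\<Sum>i=1..n. L2_set (f i) {..<d})"
    unfolding L2_set_scale[of "1 / real n"] by (simp add: divide_right_mono L2_set_sum)
  also have "(\<Sum>i=1..n. L2_set (f i) {..<d})
      = (\<Sum>i\<in>G. L2_set (f i) {..<d}) + (\<Sum>i\<in>?H. L2_set (f i) {..<d})"
    using sum.subset_diff[OF assms(3), of "\<lambda>i. L2_set (f i) {..<d}"] by simp
  also have "(\<Sum>i\<in>G. L2_set (f i) {..<d}) = (\<Sum>i\<in>G. max 0 (vdist d (x i) v - t))"
  proof (intro sum.cong refl)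
    fix i assume "i \<in> G"
    then have "L2_set (f i) {..<d} = \<bar>?c i - 1\<bar> * vdist d (x i) v"
      unfolding f_def by (simp add: L2_set_scale vdist_def)
    then show "L2_set (f i) {..<d} = max 0 (vdist d (x i) v - t)"
      using clip_factor_residual(1)[OF assms(1), of "vdist d (x i) v"] by (simp add: mult.commute)
  qed
  also have "(\<Sum>i\<in>?H. L2_set (f i) {..<d}) \<le> (\<Sum>i\<in>?H. vdist d v m + t)"
  proof (intro sum_mono)
    fix i assume "i \<in> ?H"
    then have "L2_set (f i) {..<d} \<le> L2_set (\<lambda>k. ?c i * (x i k - v k)) {..<d} + vdist d v m"
      unfolding f_def vdist_def using L2_set_triangle_ineq by simp
    also have "L2_set (\<lambda>k. ?c i * (x i k - v k)) {..<d} = vdist d (x i) v * \<bar>?c i\<bar>"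
      by (simp add: L2_set_scale vdist_def)
    also have "\<dots> \<le> t" using clip_factor_residual(2)[OF assms(1)] by simp
    finally show "L2_set (f i) {..<d} \<le> vdist d v m + t" by simp
  qed
  also have "\<dots> = (real n - real (card G)) * (vdist d v m + t)" using cH by simp
  finally show ?thesis by (simp add: mult_left_mono divide_right_mono)
qed

lemma vdist_clip_step_infinity:
  assumes "1 \<le> n"
  shows "vdist d (clip_step d n \<infinity> x v) (good_mean d {1..n} x) = 0"
proof -
  have "clip_step d n \<infinity> x v = good_mean d {1..n} x"
    unfolding clip_step_def good_mean_def using assms
    by (intro restrict_ext) (simp add: sum_subtractf field_simps)
  then show ?thesis by (simp add: vdist_def L2_set_def)
qed

text \<open>
  While the scale \<open>r l\<close> dominates the noise \<open>A\<close>, the error halves with it. Once it does not, the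
  remaining steps move the point by at most the geometric tail \<open>4 * r l\<close>, which is itself of the
  order of the noise. The disjunction \<open>inv\<close> of the two cases is therefore an invariant.
\<close>

lemma clipping_recursion:
  fixes D r :: "nat \<Rightarrow> real"
  assumes r: "\<And>l. 0 < r l" "\<And>l. r (Suc l) = r l / 2"
    and \<delta>: "0 \<le> \<delta>" "\<delta> \<le> 1 / 10" and A: "0 \<le> A"
    and start: "D 0 \<le> r 0 / 2 + N"
    and contract: "\<And>l. \<lbrakk>l \<le> K; D l \<le> r l\<rbrakk> \<Longrightarrow> D (Suc l) \<le> A + 3 * \<delta> * r l"
    and move: "\<And>l. D (Suc l) \<le> D l + 2 * r l"
  shows "D (Suc K) \<le> max (3 * \<delta> * r K + A) (max (25 * A) (10 * N))"
proof -
  \<comment> \<open>If \<open>A > r l / 5\<close> while \<open>D l \<le> r l\<close>, then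
    \<open>D (Suc l) + 4 * r (Suc l) \<le> 5 * r l < 25 * A\<close>. If \<open>N > r 0 / 2\<close>
    at the start, then \<open>D 0 + 4 * r 0 \<le> 9 / 2 * r 0 + N < 10 * N\<close>.\<close>
  let ?E = "max (25 * A) (10 * N)"
  have inv: "D l \<le> r l \<or> D l + 4 * r l \<le> ?E" if "l \<le> K" for l
    using that
  proof (induction l)
    case 0
    show ?case
    proof (cases "N \<le> r 0 / 2")
      case False
      then have "D 0 + 4 * r 0 \<le> 10 * N" using start by simp
      then show ?thesis by (simp add: le_max_iff_disj)
    qed (use start in simp)
  next
    case (Suc l)
    then consider "D l \<le> r l" | "D l + 4 * r l \<le> ?E" by auto
    then show ?case
    proof cases
      case 1
      show ?thesis
      proof (cases "A \<le> r l / 5")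
        \<comment> \<open>Here \<open>3 * \<delta> * r l \<le> 3 / 10 * r l\<close>, and adding
          \<open>A \<le> r l / 5\<close> gives at most \<open>r l / 2 = r (Suc l)\<close>.\<close>
        case True
        have "D (Suc l) \<le> A + 3 * \<delta> * r l" using contract 1 Suc.prems by simp
        moreover have "\<delta> * r l \<le> 1 / 10 * r l"
          using \<delta> r(1)[of l] by (intro mult_right_mono) auto
        ultimately show ?thesis using True r(2)[of l] by simp
      next
        case False
        then have "D (Suc l) + 4 * r (Suc l) \<le> 25 * A" using move[of l] r(2)[of l] 1 by simp
        then show ?thesis by (simp add: le_max_iff_disj)
      qed
    next
      case 2
      then show ?thesis using move[of l] r(2)[of l] by simp
    qed
  qed
  \<comment> \<open>The first alternative contracts once more; in the second the last step stays
    within the reserve \<open>4 * r K\<close>.\<close>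
  from inv[of K] show ?thesis
    using contract[of K] move[of K] r(1)[of K] by auto
qed

section \<open>Square-integrable random variables\<close>

text \<open>Measurability is a separate conjunct because that of \<open>f\<close> does not follow
  from that of its square.\<close>

definition square_integrable :: "'w measure \<Rightarrow> ('w \<Rightarrow> real) \<Rightarrow> bool" where
  "square_integrable M f \<longleftrightarrow> f \<in> borel_measurable M \<and> integrable M (\<lambda>\<omega>. (f \<omega>)\<^sup>2)"

lemma square_integrable_cmult: "square_integrable M f \<Longrightarrow> square_integrable M (\<lambda>\<omega>. c * f \<omega>)"
  by (auto simp: square_integrable_def power_mult_distrib)

lemma square_integrable_bound:
  assumes "square_integrable M f" and g [measurable]: "g \<in> borel_measurable M"
    and le: "\<And>\<omega>. \<bar>g \<omega>\<bar> \<le> \<bar>f \<omega>\<bar>"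
  shows "square_integrable M g"
  unfolding square_integrable_def
proof
  have "integrable M (\<lambda>\<omega>. (f \<omega>)\<^sup>2)" using assms(1) by (simp add: square_integrable_def)
  then show "integrable M (\<lambda>\<omega>. (g \<omega>)\<^sup>2)"
  proof (rule Bochner_Integration.integrable_bound)
    show "AE \<omega> in M. norm ((g \<omega>)\<^sup>2) \<le> norm ((f \<omega>)\<^sup>2)"
      using abs_le_square_iff[THEN iffD1, OF le] by (intro AE_I2) simp
  qed measurable
qed (rule g)

lemma square_integrable_add:
  assumes f: "square_integrable M f" and g: "square_integrable M g"
  shows "square_integrable M (\<lambda>\<omega>. f \<omega> + g \<omega>)"
  unfolding square_integrable_def
proof
  have [measurable]: "f \<in> borel_measurable M" "g \<in> borel_measurable M"
    using f g by (auto simp: square_integrable_def)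
  show "(\<lambda>\<omega>. f \<omega> + g \<omega>) \<in> borel_measurable M" by measurable
  have le: "(f \<omega> + g \<omega>)\<^sup>2 \<le> 2 * (f \<omega>)\<^sup>2 + 2 * (g \<omega>)\<^sup>2" for \<omega>
    using sum_squares_bound[of "f \<omega>" "g \<omega>"] by (simp add: power2_sum)
  have "integrable M (\<lambda>\<omega>. 2 * (f \<omega>)\<^sup>2 + 2 * (g \<omega>)\<^sup>2)"
    using f g by (simp add: square_integrable_def)
  then show "integrable M (\<lambda>\<omega>. (f \<omega> + g \<omega>)\<^sup>2)"
  proof (rule Bochner_Integration.integrable_bound)
    show "AE \<omega> in M. norm ((f \<omega> + g \<omega>)\<^sup>2) \<le> norm (2 * (f \<omega>)\<^sup>2 + 2 * (g \<omega>)\<^sup>2)"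
      using le by (intro AE_I2) simp
  qed measurable
qed

lemma square_integrable_sum:
  "(\<And>i. i \<in> I \<Longrightarrow> square_integrable M (f i)) \<Longrightarrow> square_integrable M (\<lambda>\<omega>. \<Sum>i\<in>I. f i \<omega>)"
proof (induction I rule: infinite_finite_induct)
  case (insert i I)
  then show ?case by (simp add: square_integrable_add)
qed (auto simp: square_integrable_def)

context prob_space
begin

lemma square_integrable_const: "square_integrable M (\<lambda>_. c)"
  by (simp add: square_integrable_def)

lemma square_integrable_diff_const:
  "square_integrable M f \<Longrightarrow> square_integrable M (\<lambda>\<omega>. f \<omega> - c)"
  using square_integrable_add[OF _ square_integrable_const, of f "- c"] by simp

lemma square_integrable_integrable: "square_integrable M f \<Longrightarrow> integrable M f"
  unfolding square_integrable_def by (metis square_integrable_imp_integrable)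

text \<open>The bias-variance decomposition. Depending on which term is dropped, it bounds a
  variance or a squared mean by the second moment.\<close>

lemma expectation_square_eq:
  assumes "square_integrable M f"
  shows "expectation (\<lambda>\<omega>. (f \<omega>)\<^sup>2) = (expectation f)\<^sup>2 + expectation (\<lambda>\<omega>. (f \<omega> - expectation f)\<^sup>2)"
  using variance_eq[of f] assms square_integrable_integrable[OF assms]
  by (simp add: square_integrable_def)

text \<open>The mixed terms vanish: by independence their expectations are products of means, which
  are zero.\<close>

lemma expectation_square_indep_sum:
  assumes "finite I" "indep_vars (\<lambda>_. borel) Y I"
    and "\<And>i. i \<in> I \<Longrightarrow> square_integrable M (Y i)"
    and "\<And>i. i \<in> I \<Longrightarrow> expectation (Y i) = 0"
  shows "expectation (\<lambda>\<omega>. (\<Sum>i\<in>I. Y i \<omega>)\<^sup>2) = (\<Sum>i\<in>I. expectation (\<lambda>\<omega>. (Y i \<omega>)\<^sup>2))"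
  using assms
proof (induction I rule: finite_induct)
  case (insert i I)
  let ?S = "\<lambda>\<omega>. \<Sum>i\<in>I. Y i \<omega>"
  have ind: "indep_var borel (Y i) borel ?S"
    using insert.hyps insert.prems by (intro indep_vars_sum)
  have sq: "square_integrable M (Y i)" "square_integrable M ?S"
    using insert.prems by (auto intro: square_integrable_sum)
  note int = sq[THEN square_integrable_integrable]
  have int2: "integrable M (\<lambda>\<omega>. (Y i \<omega>)\<^sup>2)" "integrable M (\<lambda>\<omega>. (?S \<omega>)\<^sup>2)"
    using sq by (auto simp: square_integrable_def)
  have IH: "expectation (\<lambda>\<omega>. (?S \<omega>)\<^sup>2) = (\<Sum>i\<in>I. expectation (\<lambda>\<omega>. (Y i \<omega>)\<^sup>2))"
    using insert.prems by (intro insert.IH) (auto intro: indep_vars_subset)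
  have "expectation (\<lambda>\<omega>. (\<Sum>i\<in>insert i I. Y i \<omega>)\<^sup>2)
      = expectation (\<lambda>\<omega>. ((Y i \<omega>)\<^sup>2 + (?S \<omega>)\<^sup>2) + 2 * (Y i \<omega> * ?S \<omega>))"
    using insert.hyps by (simp add: power2_sum algebra_simps)
  also have "\<dots> = expectation (\<lambda>\<omega>. (Y i \<omega>)\<^sup>2) + expectation (\<lambda>\<omega>. (?S \<omega>)\<^sup>2)
      + 2 * expectation (\<lambda>\<omega>. Y i \<omega> * ?S \<omega>)"
    using int2 indep_var_integrable[OF ind int] by simp
  also have "expectation (\<lambda>\<omega>. Y i \<omega> * ?S \<omega>) = 0"
    unfolding indep_var_lebesgue_integral[OF ind int] using insert.prems by simp
  finally show ?case using insert.hyps IH by simp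
qed simp

lemma expectation_square_indep_diff:
  assumes "indep_vars (\<lambda>_. borel) Y I" "i \<in> I" "j \<in> I" "i \<noteq> j"
    and sq: "square_integrable M (Y i)" "square_integrable M (Y j)"
  shows "expectation (\<lambda>\<omega>. (Y i \<omega> - Y j \<omega>)\<^sup>2) = (expectation (Y i) - expectation (Y j))\<^sup>2
    + expectation (\<lambda>\<omega>. (Y i \<omega> - expectation (Y i))\<^sup>2) + expectation (\<lambda>\<omega>. (Y j \<omega> - expectation (Y j))\<^sup>2)"
proof -
  let ?e = "\<lambda>l. expectation (Y l)"
  note int = sq[THEN square_integrable_integrable]
  \<comment> \<open>The sign flip at \<open>j\<close> turns the centered difference into a sum of
    two independent centered variables.\<close>
  define Z where "Z l \<omega> = (if l = i then Y i \<omega> - ?e i else - (Y l \<omega> - ?e l))" for l \<omega>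
  have "indep_vars (\<lambda>_. borel) Y {i, j}"
    using assms by (intro indep_vars_subset[OF assms(1)]) auto
  then have "indep_vars (\<lambda>_. borel) (\<lambda>l \<omega>. (\<lambda>y. if l = i then y - ?e i else - (y - ?e l)) (Y l \<omega>)) {i, j}"
    by (rule indep_vars_compose2) (auto simp: measurable_If)
  then have "indep_vars (\<lambda>_. borel) Z {i, j}"
    by (rule indep_vars_cong[THEN iffD1, rotated -1]) (auto simp: Z_def)
  then have "expectation (\<lambda>\<omega>. (\<Sum>l\<in>{i, j}. Z l \<omega>)\<^sup>2) = (\<Sum>l\<in>{i, j}. expectation (\<lambda>\<omega>. (Z l \<omega>)\<^sup>2))"
    using sq[THEN square_integrable_diff_const]
      square_integrable_cmult[OF sq(2)[THEN square_integrable_diff_const], of "-1"] int assms(4)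
    by (intro expectation_square_indep_sum) (auto simp: Z_def[abs_def] prob_space)
  then have "expectation (\<lambda>\<omega>. (Y i \<omega> - Y j \<omega> - (?e i - ?e j))\<^sup>2)
      = expectation (\<lambda>\<omega>. (Y i \<omega> - ?e i)\<^sup>2) + expectation (\<lambda>\<omega>. (Y j \<omega> - ?e j)\<^sup>2)"
    using assms(4) by (simp add: Z_def algebra_simps power2_commute)
  moreover have "square_integrable M (\<lambda>\<omega>. Y i \<omega> - Y j \<omega>)"
    using square_integrable_add[OF sq(1) square_integrable_cmult[OF sq(2), of "-1"]] by simp
  ultimately show ?thesis
    using expectation_square_eq[of "\<lambda>\<omega>. Y i \<omega> - Y j \<omega>"] int by simp
qed

end

section \<open>Moments of the good vectors\<close>

text \<open>
  A lower bound of two on the number of vectors is what makes \<open>spread\<close> control their variances: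
  the bound is void for a single vector of arbitrary law.
\<close>

locale good_sample = prob_space M for M :: "'w measure" +
  fixes d :: nat and G :: "nat set" and x :: "nat \<Rightarrow> 'w \<Rightarrow> nat \<Rightarrow> real" and \<rho> :: real
  assumes fin: "finite G" and card: "2 \<le> card G"
    and indep: "indep_vars (\<lambda>_. rspace d) x G"
    and sq_int: "\<lbrakk>i \<in> G; k < d\<rbrakk> \<Longrightarrow> square_integrable M (\<lambda>\<omega>. x i \<omega> k)"
    and spread: "\<lbrakk>i \<in> G; j \<in> G\<rbrakk> \<Longrightarrow> (\<Sum>k<d. expectation (\<lambda>\<omega>. (x i \<omega> k - x j \<omega> k)\<^sup>2)) \<le> \<rho>\<^sup>2"
    and \<rho>: "0 \<le> \<rho>"
begin

definition \<mu> :: "nat \<Rightarrow> nat \<Rightarrow> real" where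
  "\<mu> i k = expectation (\<lambda>\<omega>. x i \<omega> k)"

text \<open>By linearity this is the expectation of the good mean. Being deterministic, it lets
  clipping losses be bounded without reference to the iterates.\<close>

definition center :: "nat \<Rightarrow> real" where
  "center = good_mean d G \<mu>"

abbreviation deviation :: "nat \<Rightarrow> 'w \<Rightarrow> real" where
  "deviation i \<omega> \<equiv> vdist d (x i \<omega>) (\<mu> i)"

abbreviation mean_deviation :: "'w \<Rightarrow> real" where
  "mean_deviation \<omega> \<equiv> vdist d (good_mean d G (\<lambda>i. x i \<omega>)) center"

lemma nonempty: "G \<noteq> {}"
  using card by auto

lemma indep_coordinate: "k < d \<Longrightarrow> indep_vars (\<lambda>_. borel) (\<lambda>i \<omega>. x i \<omega> k) G"
  by (rule indep_vars_compose2[OF indep]) (auto simp: rspace_def)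

lemma sq_int_centered:
  "\<lbrakk>i \<in> G; k < d\<rbrakk> \<Longrightarrow> square_integrable M (\<lambda>\<omega>. x i \<omega> k - \<mu> i k)"
  by (intro square_integrable_diff_const sq_int)

lemma integrable_centered:
  "\<lbrakk>i \<in> G; k < d\<rbrakk> \<Longrightarrow> integrable M (\<lambda>\<omega>. (x i \<omega> k - \<mu> i k)\<^sup>2)"
  using sq_int_centered by (simp add: square_integrable_def)

lemma expectation_deviation_sq:
  assumes "i \<in> G"
  shows "integrable M (\<lambda>\<omega>. (deviation i \<omega>)\<^sup>2)"
    and "expectation (\<lambda>\<omega>. (deviation i \<omega>)\<^sup>2) = (\<Sum>k<d. expectation (\<lambda>\<omega>. (x i \<omega> k - \<mu> i k)\<^sup>2))"
  using assms integrable_centered by (auto simp: vdist_sq)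

text \<open>By independence, every coordinate of the mean squared distance splits into a squared
  difference of means and two variances. All three parts are nonnegative, so the assumption on pairs
  controls each of them.\<close>

lemma spread_decomposition:
  assumes "i \<in> G" "j \<in> G" "i \<noteq> j"
  shows "(vdist d (\<mu> i) (\<mu> j))\<^sup>2 + expectation (\<lambda>\<omega>. (deviation i \<omega>)\<^sup>2)
      + expectation (\<lambda>\<omega>. (deviation j \<omega>)\<^sup>2) \<le> \<rho>\<^sup>2"
proof -
  have "(\<Sum>k<d. expectation (\<lambda>\<omega>. (x i \<omega> k - x j \<omega> k)\<^sup>2))
      = (\<Sum>k<d. (\<mu> i k - \<mu> j k)\<^sup>2 + expectation (\<lambda>\<omega>. (x i \<omega> k - \<mu> i k)\<^sup>2)
          + expectation (\<lambda>\<omega>. (x j \<omega> k - \<mu> j k)\<^sup>2))"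
    using assms unfolding \<mu>_def
    by (intro sum.cong refl expectation_square_indep_diff[OF indep_coordinate]) (auto intro: sq_int)
  then show ?thesis
    using spread[OF assms(1,2)]
    unfolding expectation_deviation_sq(2)[OF assms(1)] expectation_deviation_sq(2)[OF assms(2)]
    by (simp add: vdist_sq sum.distrib)
qed

lemma deviation_le:
  assumes "i \<in> G"
  shows "expectation (\<lambda>\<omega>. (deviation i \<omega>)\<^sup>2) \<le> \<rho>\<^sup>2"
proof -
  obtain j where j: "j \<in> G" "i \<noteq> j"
    using card assms fin by (metis card_le_Suc0_iff_eq not_less_eq_eq numeral_2_eq_2)
  have "0 \<le> expectation (\<lambda>\<omega>. (deviation j \<omega>)\<^sup>2)" by simp
  then show ?thesis
    using spread_decomposition[OF assms j] zero_le_power2[of "vdist d (\<mu> i) (\<mu> j)"] by linarith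
qed

lemma vdist_mean_mean_le:
  assumes "i \<in> G" "j \<in> G"
  shows "vdist d (\<mu> i) (\<mu> j) \<le> \<rho>"
proof (cases "i = j")
  case False
  have "0 \<le> expectation (\<lambda>\<omega>. (deviation i \<omega>)\<^sup>2)" "0 \<le> expectation (\<lambda>\<omega>. (deviation j \<omega>)\<^sup>2)" by simp_all
  then have "(vdist d (\<mu> i) (\<mu> j))\<^sup>2 \<le> \<rho>\<^sup>2"
    using spread_decomposition[OF assms False] by linarith
  then show ?thesis using \<rho> by (rule power2_le_imp_le)
qed (use \<rho> in \<open>simp add: vdist_def L2_set_def\<close>)

lemma vdist_mean_center_le:
  assumes "i \<in> G"
  shows "vdist d (\<mu> i) center \<le> \<rho>"
proof -
  let ?m = "real (card G)"
  have m: "?m > 0" using card by simp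
  have "vdist d (\<mu> i) center = L2_set (\<lambda>k. 1 / ?m * (\<Sum>j\<in>G. \<mu> i k - \<mu> j k)) {..<d}"
    unfolding vdist_def center_def good_mean_def using m
    by (intro L2_set_cong) (auto simp: sum_subtractf field_simps)
  also have "\<dots> \<le> 1 / ?m * (\<Sum>j\<in>G. vdist d (\<mu> i) (\<mu> j))"
    unfolding L2_set_scale[of "1 / ?m"] vdist_def by (simp add: divide_right_mono L2_set_sum)
  also have "\<dots> \<le> 1 / ?m * (\<Sum>j\<in>G. \<rho>)"
    using vdist_mean_mean_le[OF assms] by (intro mult_left_mono sum_mono) auto
  finally show ?thesis using m by simp
qed

lemma mean_deviation_sq:
  "(mean_deviation \<omega>)\<^sup>2 = (\<Sum>k<d. (\<Sum>i\<in>G. x i \<omega> k - \<mu> i k)\<^sup>2) / (real (card G))\<^sup>2"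
  unfolding vdist_sq sum_divide_distrib
  by (intro sum.cong)
     (auto simp: good_mean_def center_def sum_subtractf diff_divide_distrib simp flip: power_divide)

text \<open>Centering each vector at its own \<open>\<mu> i\<close> leaves independent variables of
  mean zero in every coordinate, even if the means differ. The variance of their sum is of order
  \<open>card G\<close>, and averaging divides it by the square of \<open>card G\<close>.\<close>

lemma expectation_mean_deviation:
  shows "integrable M (\<lambda>\<omega>. (mean_deviation \<omega>)\<^sup>2)"
    and "expectation (\<lambda>\<omega>. (mean_deviation \<omega>)\<^sup>2) \<le> \<rho>\<^sup>2 / real (card G)"
proof -
  let ?m = "real (card G)"
  have m: "?m > 0" using card by simp
  have int: "integrable M (\<lambda>\<omega>. (\<Sum>i\<in>G. x i \<omega> k - \<mu> i k)\<^sup>2)" if "k < d" for k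
    using square_integrable_sum[of G M "\<lambda>i \<omega>. x i \<omega> k - \<mu> i k"] sq_int_centered that
    by (simp add: square_integrable_def)
  show "integrable M (\<lambda>\<omega>. (mean_deviation \<omega>)\<^sup>2)"
    unfolding mean_deviation_sq using int
    by (intro Bochner_Integration.integrable_divide_zero Bochner_Integration.integrable_sum) simp
  have "expectation (\<lambda>\<omega>. (\<Sum>i\<in>G. x i \<omega> k - \<mu> i k)\<^sup>2) = (\<Sum>i\<in>G. expectation (\<lambda>\<omega>. (x i \<omega> k - \<mu> i k)\<^sup>2))"
    if k: "k < d" for k
  proof (rule expectation_square_indep_sum[OF fin])
    show "indep_vars (\<lambda>_. borel) (\<lambda>i \<omega>. x i \<omega> k - \<mu> i k) G"
      using indep_vars_compose2[OF indep_coordinate[OF k], of "\<lambda>i y. y - \<mu> i k"] by simp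
    fix i assume i: "i \<in> G"
    show "square_integrable M (\<lambda>\<omega>. x i \<omega> k - \<mu> i k)" using sq_int_centered i k by simp
    show "expectation (\<lambda>\<omega>. x i \<omega> k - \<mu> i k) = 0"
      using square_integrable_integrable[OF sq_int[OF i k]] by (simp add: \<mu>_def prob_space)
  qed
  then have "expectation (\<lambda>\<omega>. (mean_deviation \<omega>)\<^sup>2)
      = (\<Sum>k<d. \<Sum>i\<in>G. expectation (\<lambda>\<omega>. (x i \<omega> k - \<mu> i k)\<^sup>2)) / ?m\<^sup>2"
    unfolding mean_deviation_sq using int by simp
  also have "\<dots> = (\<Sum>i\<in>G. expectation (\<lambda>\<omega>. (deviation i \<omega>)\<^sup>2)) / ?m\<^sup>2"
    by (subst sum.swap) (simp add: expectation_deviation_sq)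
  also have "\<dots> \<le> (\<Sum>i\<in>G. \<rho>\<^sup>2) / ?m\<^sup>2"
    by (intro divide_right_mono sum_mono deviation_le) auto
  also have "\<dots> = \<rho>\<^sup>2 / ?m" using m by (simp add: power2_eq_square)
  finally show "expectation (\<lambda>\<omega>. (mean_deviation \<omega>)\<^sup>2) \<le> \<rho>\<^sup>2 / ?m" .
qed

section \<open>Excess of the deviations over a threshold\<close>

lemma vdist_measurable: "(\<lambda>u. vdist d u v) \<in> borel_measurable (rspace d)"
  unfolding vdist_def L2_set_def rspace_def by measurable

abbreviation excess :: "real \<Rightarrow> nat \<Rightarrow> 'w \<Rightarrow> real" where
  "excess s i \<omega> \<equiv> max 0 (deviation i \<omega> - s)"

text \<open>The first moment is the bias that clipping inflicts on a good vector. Its bound decays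
  like \<open>1 / s\<close>, whereas the second moment is just compared with that of the
  deviation.\<close>

lemma expectation_excess:
  assumes "0 < s" "i \<in> G"
  shows "square_integrable M (excess s i)"
    and "expectation (\<lambda>\<omega>. (excess s i \<omega>)\<^sup>2) \<le> \<rho>\<^sup>2"
    and "expectation (excess s i) \<le> \<rho>\<^sup>2 / (4 * s)"
proof -
  have "x i \<in> M \<rightarrow>\<^sub>M rspace d" using indep assms(2) unfolding indep_vars_def by auto
  note [measurable] = measurable_compose[OF this vdist_measurable]
  have dev: "square_integrable M (deviation i)"
    using expectation_deviation_sq(1)[OF assms(2)] by (simp add: square_integrable_def)
  have le: "\<bar>excess s i \<omega>\<bar> \<le> \<bar>deviation i \<omega>\<bar>" for \<omega> using assms by simp
  show sq: "square_integrable M (excess s i)"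
    by (rule square_integrable_bound[OF dev _ le]) measurable
  have "expectation (\<lambda>\<omega>. (excess s i \<omega>)\<^sup>2) \<le> expectation (\<lambda>\<omega>. (deviation i \<omega>)\<^sup>2)"
    using sq dev le[THEN abs_le_square_iff[THEN iffD1]]
    by (intro integral_mono) (auto simp: square_integrable_def)
  then show "expectation (\<lambda>\<omega>. (excess s i \<omega>)\<^sup>2) \<le> \<rho>\<^sup>2"
    using deviation_le[OF assms(2)] by linarith
  have "excess s i \<omega> \<le> (deviation i \<omega>)\<^sup>2 / (4 * s)" for \<omega>
  proof -
    \<comment> \<open>This is \<open>(deviation i \<omega> - 2 * s)\<^sup>2 \<ge> 0\<close>
      expanded, the source of the constant 4.\<close>
    have "(deviation i \<omega> - s) * (4 * s) \<le> (deviation i \<omega>)\<^sup>2"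
      using zero_le_power2[of "deviation i \<omega> - 2 * s"]
      by (simp add: power2_eq_square algebra_simps)
    then have "deviation i \<omega> - s \<le> (deviation i \<omega>)\<^sup>2 / (4 * s)"
      using assms by (subst pos_le_divide_eq) auto
    then show ?thesis using assms by simp
  qed
  then have "expectation (excess s i) \<le> expectation (\<lambda>\<omega>. (deviation i \<omega>)\<^sup>2 / (4 * s))"
    using dev square_integrable_integrable[OF sq]
    by (intro integral_mono) (simp_all add: square_integrable_def)
  also have "\<dots> \<le> \<rho>\<^sup>2 / (4 * s)"
    using deviation_le[OF assms(2)] assms by (simp add: divide_right_mono)
  finally show "expectation (excess s i) \<le> \<rho>\<^sup>2 / (4 * s)" .
qed

text \<open>The excesses are nonnegative and in general not centered. Their sum is split into its
  mean, of order \<open>card G\<close>, and a fluctuation whose variance is also only of order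
  \<open>card G\<close>, by independence.\<close>

lemma expectation_sum_excess_sq:
  assumes s: "0 < s"
  shows "integrable M (\<lambda>\<omega>. (\<Sum>i\<in>G. excess s i \<omega>)\<^sup>2)"
    and "expectation (\<lambda>\<omega>. (\<Sum>i\<in>G. excess s i \<omega>)\<^sup>2)
      \<le> (real (card G) * (\<rho>\<^sup>2 / (4 * s)))\<^sup>2 + real (card G) * \<rho>\<^sup>2"
proof -
  let ?e = "\<lambda>i. expectation (excess s i)"
  have S: "square_integrable M (\<lambda>\<omega>. \<Sum>i\<in>G. excess s i \<omega>)"
    by (intro square_integrable_sum expectation_excess s)
  then show "integrable M (\<lambda>\<omega>. (\<Sum>i\<in>G. excess s i \<omega>)\<^sup>2)" by (simp add: square_integrable_def)
  have int: "integrable M (excess s i)" if "i \<in> G" for i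
    by (intro square_integrable_integrable expectation_excess s that)
  have eS: "expectation (\<lambda>\<omega>. \<Sum>i\<in>G. excess s i \<omega>) = (\<Sum>i\<in>G. ?e i)"
    using int by simp
  have "expectation (\<lambda>\<omega>. (\<Sum>i\<in>G. excess s i \<omega> - ?e i)\<^sup>2)
      = (\<Sum>i\<in>G. expectation (\<lambda>\<omega>. (excess s i \<omega> - ?e i)\<^sup>2))"
  proof (rule expectation_square_indep_sum[OF fin])
    show "indep_vars (\<lambda>_. borel) (\<lambda>i \<omega>. excess s i \<omega> - ?e i) G"
      by (rule indep_vars_compose2[OF indep, of "\<lambda>i u. max 0 (vdist d u (\<mu> i) - s) - ?e i"])
         (use vdist_measurable in measurable)
  qed (use int in \<open>auto intro!: square_integrable_diff_const expectation_excess s simp: prob_space\<close>)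
  also have "\<dots> \<le> (\<Sum>i\<in>G. \<rho>\<^sup>2)"
  proof (intro sum_mono)
    fix i assume "i \<in> G"
    note expectation_square_eq[OF expectation_excess(1)[OF s this]] expectation_excess(2)[OF s this]
    then show "expectation (\<lambda>\<omega>. (excess s i \<omega> - ?e i)\<^sup>2) \<le> \<rho>\<^sup>2"
      using zero_le_power2[of "?e i"] by linarith
  qed
  finally have "expectation (\<lambda>\<omega>. (\<Sum>i\<in>G. excess s i \<omega> - ?e i)\<^sup>2) \<le> real (card G) * \<rho>\<^sup>2" by simp
  moreover have "(\<Sum>i\<in>G. ?e i)\<^sup>2 \<le> (real (card G) * (\<rho>\<^sup>2 / (4 * s)))\<^sup>2"
    using sum_bounded_above[of G ?e "\<rho>\<^sup>2 / (4 * s)"] expectation_excess(3)[OF s]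
    by (intro power_mono sum_nonneg) (auto simp: mult.commute)
  ultimately show "expectation (\<lambda>\<omega>. (\<Sum>i\<in>G. excess s i \<omega>)\<^sup>2)
      \<le> (real (card G) * (\<rho>\<^sup>2 / (4 * s)))\<^sup>2 + real (card G) * \<rho>\<^sup>2"
    unfolding expectation_square_eq[OF S] eS by (simp add: sum_subtractf)
qed

end

section \<open>The error of centered clipping\<close>

text \<open>A deterministic estimate for one fixed sample. The points \<open>\<nu> i\<close> and
  \<open>c\<close> stand for the expectations of the good vectors and of their mean; only their
  distances enter.\<close>

lemma centered_clipping_error:
  fixes d n :: nat and x \<nu> :: "nat \<Rightarrow> nat \<Rightarrow> real"
  assumes n: "1 \<le> n" and G: "G \<subseteq> {1..n}" "G \<noteq> {}" "(1 - \<delta>) * real n \<le> real (card G)"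
    and \<delta>: "0 \<le> \<delta>" "\<delta> \<le> 1 / 10" and T: "0 < T"
    and \<nu>: "\<And>i. i \<in> G \<Longrightarrow> vdist d (\<nu> i) c \<le> T / 2"
    and v0: "2 * vdist d v0 c \<le> T * 2 ^ K"
  defines "m \<equiv> good_mean d G x"
  defines "A \<equiv> vdist d m c + 1 / real n * (\<Sum>i\<in>G. max 0 (vdist d (x i) (\<nu> i) - T / 2))"
  shows "vdist d (centered_clipping d n (\<lambda>l. ereal (2 * (T * 2 ^ K / 2 ^ l))) v0 x (Suc K)) m
    \<le> max (3 * \<delta> * T + A) (max (25 * A) (10 * vdist d m c))"
proof -
  \<comment> \<open>\<open>r 0 = T * 2 ^ K\<close> covers twice the initial distance to
    \<open>c\<close>, and \<open>r K = T\<close>, so the last of the \<open>Suc K\<close> steps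
    clips at \<open>2 * T\<close>.\<close>
  define r where "r l = T * 2 ^ K / 2 ^ l" for l :: nat
  let ?v = "centered_clipping d n (\<lambda>l. ereal (2 * r l)) v0 x"
  let ?D = "\<lambda>l. vdist d (?v l) m"
  let ?N = "vdist d m c"
  have fin: "finite G" using G(1) finite_subset by auto
  have card: "real (card G) \<le> real n" using card_mono[OF _ G(1)] by simp
  have r0: "0 < r l" for l using T by (simp add: r_def)
  have "?D (Suc K) \<le> max (3 * \<delta> * r K + A) (max (25 * A) (10 * ?N))"
  proof (rule clipping_recursion[OF r0 _ \<delta>])
    show "r (Suc l) = r l / 2" for l by (simp add: r_def)
    show "0 \<le> A" by (simp add: A_def sum_nonneg)
    show "?D 0 \<le> r 0 / 2 + ?N"
      using vdist_triangle[of d v0 m c] v0 vdist_commute[of d m c] by (simp add: r_def)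
    show "?D (Suc l) \<le> ?D l + 2 * r l" for l
      using vdist_triangle[of d "?v (Suc l)" m "?v l"]
        vdist_clip_step_self[of "2 * r l" n d x "?v l"] r0[of l] n by simp
    fix l assume l: "l \<le> K" "?D l \<le> r l"
    have rT: "T \<le> r l"
    proof -
      have "(2::real) ^ l \<le> 2 ^ K" using l by (simp add: power_increasing)
      then show ?thesis using T by (simp add: r_def pos_le_divide_eq)
    qed
    \<comment> \<open>Via \<open>\<nu> i\<close>, \<open>c\<close> and \<open>m\<close> the distance
      is at most the deviation plus \<open>T / 2 + ?N + r l\<close>. As \<open>T \<le> r l\<close>,
      subtracting \<open>2 * r l\<close> leaves at most \<open>?N\<close> plus the deviation minus
      \<open>T / 2\<close>: one half of \<open>T\<close> pays for the spread of the means, the other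
      is the threshold of the excess.\<close>
    have each: "max 0 (vdist d (x i) (?v l) - 2 * r l)
        \<le> ?N + max 0 (vdist d (x i) (\<nu> i) - T / 2)" if "i \<in> G" for i
    proof -
      have "vdist d (x i) (?v l) \<le> vdist d (x i) (\<nu> i) + vdist d (\<nu> i) c + ?N + ?D l"
        using vdist_triangle[of d "x i" "?v l" "\<nu> i"] vdist_triangle[of d "\<nu> i" "?v l" c]
          vdist_triangle[of d c "?v l" m] vdist_commute[of d c m] vdist_commute[of d m "?v l"]
        by linarith
      moreover have "0 \<le> ?N" by simp
      ultimately show ?thesis using \<nu>[OF that] l(2) rT unfolding max_def by auto
    qed
    have "?D (Suc l) \<le> 1 / real n * ((\<Sum>i\<in>G. max 0 (vdist d (x i) (?v l) - 2 * r l))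
        + (real n - real (card G)) * (?D l + 2 * r l))"
      using vdist_clip_step_good_mean[of "2 * r l" n G d x "?v l"] r0[of l] n G by (simp add: m_def)
    \<comment> \<open>At most \<open>\<delta> * real n\<close> vectors are bad, each costing at most
      \<open>r l + 2 * r l\<close>.\<close>
    also have "\<dots> \<le> 1 / real n * ((\<Sum>i\<in>G. ?N + max 0 (vdist d (x i) (\<nu> i) - T / 2))
        + (\<delta> * real n) * (3 * r l))"
      using each l(2) G(3) r0[of l] card \<delta>
      by (intro mult_left_mono add_mono sum_mono mult_mono) (auto simp: algebra_simps)
    also have "\<dots> = real (card G) / real n * ?N
        + 1 / real n * (\<Sum>i\<in>G. max 0 (vdist d (x i) (\<nu> i) - T / 2)) + 3 * \<delta> * r l"
      using n by (simp add: sum.distrib field_simps)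
    also have "\<dots> \<le> A + 3 * \<delta> * r l"
      using mult_right_mono[of "real (card G) / real n" 1 ?N] card n by (simp add: A_def)
    finally show "?D (Suc l) \<le> A + 3 * \<delta> * r l" .
  qed
  then show ?thesis by (simp add: r_def)
qed

section \<open>From the pathwise bound to the mean squared error\<close>

lemma sq_le_of_le_max:
  fixes D A :: real
  assumes "0 \<le> D" "0 \<le> a" "0 \<le> N" "0 \<le> S" "A = N + S" "D \<le> max (3 * a + A) (max (25 * A) (10 * N))"
  shows "D\<^sup>2 \<le> 18 * a\<^sup>2 + 1354 * N\<^sup>2 + 1254 * S\<^sup>2"
proof -
  \<comment> \<open>The bounds of the three alternatives are added: \<open>2 * A\<^sup>2\<close>,
    \<open>625 * A\<^sup>2\<close> and \<open>100 * N\<^sup>2\<close> give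
    \<open>4 + 1250 + 100\<close> for \<open>N\<close> and \<open>4 + 1250\<close> for
    \<open>S\<close>.\<close>
  have "A\<^sup>2 \<le> 2 * N\<^sup>2 + 2 * S\<^sup>2"
    using sum_squares_bound[of N S] assms by (simp add: power2_sum)
  moreover have "(3 * a + A)\<^sup>2 \<le> 18 * a\<^sup>2 + 2 * A\<^sup>2"
    using sum_squares_bound[of "3 * a" A] by (simp add: power2_sum power_mult_distrib)
  moreover consider "D \<le> 3 * a + A" | "D \<le> 25 * A" | "D \<le> 10 * N"
    using assms(6) by (auto simp: le_max_iff_disj)
  then have "D\<^sup>2 \<le> (3 * a + A)\<^sup>2 \<or> D\<^sup>2 \<le> (25 * A)\<^sup>2 \<or> D\<^sup>2 \<le> (10 * N)\<^sup>2"
    by cases (use power_mono[OF _ assms(1), of _ 2] in blast)+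
  then have "D\<^sup>2 \<le> (3 * a + A)\<^sup>2 \<or> D\<^sup>2 \<le> 625 * A\<^sup>2 \<or> D\<^sup>2 \<le> 100 * N\<^sup>2"
    by (simp add: power_mult_distrib)
  ultimately show ?thesis
    using zero_le_power2[of a] zero_le_power2[of A] zero_le_power2[of S] zero_le_power2[of N]
    by linarith
qed

text \<open>Finiteness of the nonnegative integral makes the sum of squares integrable, and that sum
  dominates every coordinate. From here on Bochner integrals can be used.\<close>

lemma msd_le_ennreal:
  assumes meas: "\<And>k. k < d \<Longrightarrow> (\<lambda>\<omega>. X \<omega> k - Y \<omega> k) \<in> borel_measurable M"
    and le: "msd M d X Y \<le> ennreal c" and c: "0 \<le> c"
  shows "k < d \<Longrightarrow> square_integrable M (\<lambda>\<omega>. X \<omega> k - Y \<omega> k)"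
    and "(\<Sum>k<d. integral\<^sup>L M (\<lambda>\<omega>. (X \<omega> k - Y \<omega> k)\<^sup>2)) \<le> c"
proof -
  let ?f = "\<lambda>\<omega>. \<Sum>k<d. (X \<omega> k - Y \<omega> k)\<^sup>2"
  have f: "?f \<in> borel_measurable M" using meas by (intro borel_measurable_sum borel_measurable_power) auto
  have nn: "(\<integral>\<^sup>+ \<omega>. ennreal (?f \<omega>) \<partial>M) \<le> ennreal c" using le by (simp add: msd_def vdist_sq)
  have "(\<integral>\<^sup>+ \<omega>. ennreal (?f \<omega>) \<partial>M) < \<infinity>"
    using nn ennreal_less_top[of c] unfolding infinity_ennreal_def by (rule le_less_trans)
  then have int: "integrable M ?f" using f by (intro integrableI_nonneg) (auto simp: sum_nonneg)
  have "ennreal (integral\<^sup>L M ?f) \<le> ennreal c"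
    using nn nn_integral_eq_integral[OF int] by (simp add: sum_nonneg)
  then have fc: "integral\<^sup>L M ?f \<le> c" using c by simp
  have sq: "integrable M (\<lambda>\<omega>. (X \<omega> k - Y \<omega> k)\<^sup>2)" if "k < d" for k
  proof (rule Bochner_Integration.integrable_bound[OF int])
    show "(\<lambda>\<omega>. (X \<omega> k - Y \<omega> k)\<^sup>2) \<in> borel_measurable M"
      using meas[OF that] by (rule borel_measurable_power)
    have "(X \<omega> k - Y \<omega> k)\<^sup>2 \<le> ?f \<omega>" for \<omega>
      by (rule member_le_sum) (use that in auto)
    then show "AE \<omega> in M. norm ((X \<omega> k - Y \<omega> k)\<^sup>2) \<le> norm (?f \<omega>)"
      by (intro AE_I2) (simp add: sum_nonneg)
  qed
  then show "k < d \<Longrightarrow> square_integrable M (\<lambda>\<omega>. X \<omega> k - Y \<omega> k)"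
    using meas by (simp add: square_integrable_def)
  show "(\<Sum>k<d. integral\<^sup>L M (\<lambda>\<omega>. (X \<omega> k - Y \<omega> k)\<^sup>2)) \<le> c"
    using fc sq by simp
qed

text \<open>
  Only differences of good vectors are assumed to have a second moment. The bound on the starting
  point transfers this to the vectors themselves, because
  \<open>x i - v0\<close> is the sum of \<open>xbar - v0\<close> and the average of the \<open>x i - x j\<close>.
\<close>

lemma corrupted_sample_good_sample:
  assumes cs: "corrupted_sample M d n \<delta> \<rho> G x" and card: "2 \<le> card G" and \<rho>: "0 \<le> \<rho>"
    and start: "msd M d (\<lambda>_. v0) (\<lambda>\<omega>. good_mean d G (\<lambda>i. x i \<omega>)) \<le> ennreal (B\<^sup>2)" and B: "0 \<le> B"
  shows "good_sample M d G x \<rho>" and "vdist d v0 (good_sample.center M d G x) \<le> B"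
proof -
  let ?m = "\<lambda>\<omega>. good_mean d G (\<lambda>i. x i \<omega>)"
  interpret prob_space M using cs by (simp add: corrupted_sample_def)
  have G: "G \<subseteq> {1..n}" using cs by (simp add: corrupted_sample_def)
  then have fin: "finite G" using finite_subset by auto
  have indep: "indep_vars (\<lambda>_. rspace d) x G" using cs by (simp add: corrupted_sample_def)
  have meas: "(\<lambda>\<omega>. x i \<omega> k) \<in> borel_measurable M" if "i \<in> G" "k < d" for i k
  proof -
    have "x i \<in> M \<rightarrow>\<^sub>M rspace d" using that cs G by (auto simp: corrupted_sample_def)
    moreover have "(\<lambda>u. u k) \<in> rspace d \<rightarrow>\<^sub>M borel" using that by (simp add: rspace_def)
    ultimately show ?thesis by (rule measurable_compose)
  qed
  have pair: "square_integrable M (\<lambda>\<omega>. x i \<omega> k - x j \<omega> k)" if "k < d" "i \<in> G" "j \<in> G" for i j k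
    by (rule msd_le_ennreal(1)[where c = "\<rho>\<^sup>2" and d = d])
       (use that cs meas in \<open>auto simp: corrupted_sample_def\<close>)
  have measm: "(\<lambda>\<omega>. v0 k - ?m \<omega> k) \<in> borel_measurable M" if "k < d" for k
    using meas that by (simp add: good_mean_def)
  have m: "square_integrable M (\<lambda>\<omega>. v0 k - ?m \<omega> k)" if "k < d" for k
    by (rule msd_le_ennreal(1)[OF measm start zero_le_power2 that])
  have sq_int: "square_integrable M (\<lambda>\<omega>. x i \<omega> k)" if "i \<in> G" "k < d" for i k
  proof -
    have "square_integrable M (\<lambda>\<omega>. ((-1) * (v0 k - ?m \<omega> k)
        + (\<Sum>j\<in>G. 1 / real (card G) * (x i \<omega> k - x j \<omega> k))) - (- v0 k))"
      using m pair that
      by (intro square_integrable_diff_const square_integrable_add square_integrable_cmult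
          square_integrable_sum) auto
    also have "(\<lambda>\<omega>. ((-1) * (v0 k - ?m \<omega> k)
        + (\<Sum>j\<in>G. 1 / real (card G) * (x i \<omega> k - x j \<omega> k))) - (- v0 k)) = (\<lambda>\<omega>. x i \<omega> k)"
      using that(2) card
      by (intro ext) (simp add: good_mean_def sum_subtractf field_simps flip: sum_divide_distrib)
    finally show ?thesis .
  qed
  show gs: "good_sample M d G x \<rho>"
  proof (intro good_sample.intro good_sample_axioms.intro)
    fix i j assume ij: "i \<in> G" "j \<in> G"
    show "(\<Sum>k<d. expectation (\<lambda>\<omega>. (x i \<omega> k - x j \<omega> k)\<^sup>2)) \<le> \<rho>\<^sup>2"
      by (rule msd_le_ennreal(2)) (use ij cs meas in \<open>auto simp: corrupted_sample_def\<close>)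
  qed (use fin card indep sq_int \<rho> prob_space_axioms in auto)
  interpret good_sample M d G x \<rho> by (rule gs)
  \<comment> \<open>Jensen's inequality in each coordinate: a squared mean is at most the second
    moment.\<close>
  have "(v0 k - center k)\<^sup>2 \<le> expectation (\<lambda>\<omega>. (v0 k - ?m \<omega> k)\<^sup>2)" if "k < d" for k
  proof -
    have "integrable M (\<lambda>\<omega>. x i \<omega> k)" if "i \<in> G" for i
      using sq_int[OF that \<open>k < d\<close>] by (rule square_integrable_integrable)
    then have "expectation (\<lambda>\<omega>. v0 k - ?m \<omega> k) = v0 k - center k"
      using that by (simp add: center_def good_mean_def \<mu>_def prob_space)
    moreover have "0 \<le> expectation (\<lambda>\<omega>. (v0 k - ?m \<omega> k - (v0 k - center k))\<^sup>2)" by simp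
    ultimately show ?thesis
      using expectation_square_eq[OF m[OF that]] by simp
  qed
  then have "(vdist d v0 center)\<^sup>2 \<le> (\<Sum>k<d. expectation (\<lambda>\<omega>. (v0 k - ?m \<omega> k)\<^sup>2))"
    unfolding vdist_sq by (intro sum_mono) simp
  also have "\<dots> \<le> B\<^sup>2" by (rule msd_le_ennreal(2)[OF measm start zero_le_power2])
  finally show "vdist d v0 center \<le> B" using B by (rule power2_le_imp_le)
qed

text \<open>\<open>T\<close> balances the two errors at the smallest radius: bad vectors contribute
  about \<open>\<delta> * T\<close>, the bias of clipped good ones about
  \<open>\<rho>\<^sup>2 / T\<close>, and both equal \<open>sqrt \<delta> * \<rho>\<close>. The bound
  \<open>1 \<le> real n * \<delta>\<close> absorbs variances of order
  \<open>\<rho>\<^sup>2 / n\<close> into \<open>\<delta> * \<rho>\<^sup>2\<close>.\<close>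

lemma msd_centered_clipping_le:
  assumes \<delta>: "0 < \<delta>" "\<delta> \<le> 1 / 10" and n\<delta>: "1 \<le> real n * \<delta>" and \<rho>_pos: "0 < \<rho>" and B: "0 \<le> B"
    and cs: "corrupted_sample M d n \<delta> \<rho> G x"
    and start: "msd M d (\<lambda>_. v0) (\<lambda>\<omega>. good_mean d G (\<lambda>i. x i \<omega>)) \<le> ennreal (B\<^sup>2)"
  defines "T \<equiv> \<rho> / sqrt \<delta>"
  assumes K: "2 * B \<le> T * 2 ^ K"
  shows "msd M d
      (\<lambda>\<omega>. centered_clipping d n (\<lambda>l. ereal (2 * (T * 2 ^ K / 2 ^ l))) v0 (\<lambda>i. x i \<omega>) (Suc K))
      (\<lambda>\<omega>. good_mean d G (\<lambda>i. x i \<omega>)) \<le> ennreal (4000 * \<delta> * \<rho>\<^sup>2)"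
proof -
  let ?g = "real (card G)"
  have n0: "0 < real n" using n\<delta> \<delta> by (cases n) auto
  have "real n * \<delta> \<le> real n * (1 / 10)" by (rule mult_left_mono) (use \<delta> n0 in auto)
  then have n: "10 \<le> real n" using n\<delta> by simp
  have G: "G \<subseteq> {1..n}" "(1 - \<delta>) * real n \<le> ?g" using cs by (auto simp: corrupted_sample_def)
  have "9 / 10 * real n \<le> (1 - \<delta>) * real n" using \<delta> by (intro mult_right_mono) auto
  then have g: "9 / 10 * real n \<le> ?g" using G(2) by linarith
  have gn: "?g \<le> real n" using card_mono[OF _ G(1)] by simp
  have card: "2 \<le> card G" using g n by linarith
  interpret good_sample M d G x \<rho>
    by (rule corrupted_sample_good_sample(1)[OF cs card _ start B]) (use \<rho>_pos in simp)
  have c: "vdist d v0 center \<le> B"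
    by (rule corrupted_sample_good_sample(2)[OF cs card _ start B]) (use \<rho>_pos in simp)
  have T: "0 < T" using \<rho>_pos \<delta> by (simp add: T_def)
  have T2: "T\<^sup>2 = \<rho>\<^sup>2 / \<delta>" using \<delta> by (simp add: T_def power_divide)
  have \<rho>T: "\<rho> \<le> T / 2"
  proof (rule power2_le_imp_le)
    show "\<rho>\<^sup>2 \<le> (T / 2)\<^sup>2"
      using \<delta> \<rho>_pos unfolding power_divide T2 by (simp add: field_simps)
  qed (use T in simp)
  define S where "S \<omega> = 1 / real n * (\<Sum>i\<in>G. excess (T / 2) i \<omega>)" for \<omega>
  define F where "F \<omega> = 18 * (\<delta> * T)\<^sup>2 + 1354 * (mean_deviation \<omega>)\<^sup>2 + 1254 * (S \<omega>)\<^sup>2" for \<omega>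
  have S2: "(S \<omega>)\<^sup>2 = (\<Sum>i\<in>G. excess (T / 2) i \<omega>)\<^sup>2 / (real n)\<^sup>2" for \<omega>
    by (simp add: S_def power_divide)
  have T': "0 < T / 2" using T by simp
  have intS: "integrable M (\<lambda>\<omega>. (S \<omega>)\<^sup>2)"
    unfolding S2 using expectation_sum_excess_sq(1)[OF T'] by (rule Bochner_Integration.integrable_divide_zero)
  note intN = expectation_mean_deviation(1)
  \<comment> \<open>One quarter comes from the squared mean of the excesses, the unit from their
    fluctuation.\<close>
  have eS: "expectation (\<lambda>\<omega>. (S \<omega>)\<^sup>2) \<le> 5 / 4 * (\<delta> * \<rho>\<^sup>2)"
  proof -
    have "expectation (\<lambda>\<omega>. (S \<omega>)\<^sup>2) \<le> ((?g * (\<rho>\<^sup>2 / (4 * (T / 2))))\<^sup>2 + ?g * \<rho>\<^sup>2) / (real n)\<^sup>2"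
      unfolding S2 integral_divide_zero
      by (intro divide_right_mono expectation_sum_excess_sq(2)[OF T']) simp
    also have "\<dots> \<le> ((real n * (\<rho>\<^sup>2 / (4 * (T / 2))))\<^sup>2 + real n * \<rho>\<^sup>2) / (real n)\<^sup>2"
      using gn T by (intro divide_right_mono add_mono power_mono mult_right_mono) auto
    also have "\<dots> = \<delta> * \<rho>\<^sup>2 / 4 + \<rho>\<^sup>2 / real n"
    proof -
      have "(\<rho>\<^sup>2 / (4 * (T / 2)))\<^sup>2 = (\<rho>\<^sup>2)\<^sup>2 / (4 * T\<^sup>2)"
        by (simp add: power_divide power_mult_distrib)
      also have "\<dots> = \<delta> * \<rho>\<^sup>2 / 4" unfolding T2 using \<rho>_pos \<delta> by (simp add: field_simps power2_eq_square)
      finally show ?thesis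
        using n0 by (simp add: power_mult_distrib add_divide_distrib power2_eq_square)
    qed
    also have "\<rho>\<^sup>2 / real n \<le> \<delta> * \<rho>\<^sup>2"
      using n\<delta> n0 mult_right_mono[OF n\<delta>, of "\<rho>\<^sup>2"] by (simp add: pos_divide_le_eq algebra_simps)
    finally show ?thesis by simp
  qed
  have eN: "expectation (\<lambda>\<omega>. (mean_deviation \<omega>)\<^sup>2) \<le> 10 / 9 * (\<delta> * \<rho>\<^sup>2)"
  proof -
    have "9 / 10 \<le> 9 / 10 * real n * \<delta>" using n\<delta> by simp
    also have "\<dots> \<le> ?g * \<delta>" using g \<delta> by (intro mult_right_mono) auto
    finally have "9 / 10 \<le> ?g * \<delta>" .
    from mult_right_mono[OF this, of "\<rho>\<^sup>2"] have "\<rho>\<^sup>2 / ?g \<le> 10 / 9 * (\<delta> * \<rho>\<^sup>2)"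
      using g n by (simp add: pos_divide_le_eq algebra_simps)
    then show ?thesis using expectation_mean_deviation(2) by linarith
  qed
  have "expectation F = 18 * (\<delta> * T)\<^sup>2 + 1354 * expectation (\<lambda>\<omega>. (mean_deviation \<omega>)\<^sup>2)
      + 1254 * expectation (\<lambda>\<omega>. (S \<omega>)\<^sup>2)"
    unfolding F_def using intS intN by (simp add: prob_space)
  also have "(\<delta> * T)\<^sup>2 = \<delta> * \<rho>\<^sup>2"
    unfolding power_mult_distrib T2 using \<delta> by (simp add: power2_eq_square)
  finally have "expectation F \<le> 18 * (\<delta> * \<rho>\<^sup>2) + 1354 * (10 / 9 * (\<delta> * \<rho>\<^sup>2)) + 1254 * (5 / 4 * (\<delta> * \<rho>\<^sup>2))"
    using eS eN by simp
  \<comment> \<open>The coefficients add up to less than 3090.\<close>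
  also have "\<dots> \<le> 4000 * \<delta> * \<rho>\<^sup>2" using \<delta> by simp
  finally have eF: "expectation F \<le> 4000 * \<delta> * \<rho>\<^sup>2" .
  have intF: "integrable M F" unfolding F_def using intS intN by simp
  \<comment> \<open>\<open>F\<close> does not involve the iterates, so pointwise domination reduces
    the claim to the expectation of \<open>F\<close>.\<close>
  have "(vdist d (centered_clipping d n (\<lambda>l. ereal (2 * (T * 2 ^ K / 2 ^ l))) v0 (\<lambda>i. x i \<omega>) (Suc K))
      (good_mean d G (\<lambda>i. x i \<omega>)))\<^sup>2 \<le> F \<omega>" for \<omega>
    unfolding F_def
  proof (rule sq_le_of_le_max)
    show "vdist d (centered_clipping d n (\<lambda>l. ereal (2 * (T * 2 ^ K / 2 ^ l))) v0 (\<lambda>i. x i \<omega>) (Suc K))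
        (good_mean d G (\<lambda>i. x i \<omega>))
      \<le> max (3 * (\<delta> * T) + (mean_deviation \<omega> + S \<omega>)) (max (25 * (mean_deviation \<omega> + S \<omega>)) (10 * mean_deviation \<omega>))"
      unfolding S_def mult.assoc[symmetric, of 3]
    proof (rule centered_clipping_error[OF _ G(1) nonempty G(2) _ \<delta>(2) T])
      show "vdist d (\<mu> i) center \<le> T / 2" if "i \<in> G" for i
        using vdist_mean_center_le[OF that] \<rho>T by linarith
      show "2 * vdist d v0 center \<le> T * 2 ^ K" using c K by linarith
    qed (use \<delta> n in auto)
  qed (use \<delta> T in \<open>auto simp: S_def sum_nonneg\<close>)
  then have "msd M d
      (\<lambda>\<omega>. centered_clipping d n (\<lambda>l. ereal (2 * (T * 2 ^ K / 2 ^ l))) v0 (\<lambda>i. x i \<omega>) (Suc K))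
      (\<lambda>\<omega>. good_mean d G (\<lambda>i. x i \<omega>)) \<le> (\<integral>\<^sup>+ \<omega>. ennreal (F \<omega>) \<partial>M)"
    unfolding msd_def by (intro nn_integral_mono ennreal_leI)
  also have "\<dots> = ennreal (expectation F)"
    by (rule nn_integral_eq_integral[OF intF]) (simp add: F_def)
  also have "\<dots> \<le> ennreal (4000 * \<delta> * \<rho>\<^sup>2)" using eF by (rule ennreal_leI)
  finally show ?thesis .
qed

section \<open>Samples without bad vectors and the choice of the radii\<close>

lemma corrupted_sample_all_good:
  assumes "corrupted_sample M d n \<delta> \<rho> G x" "real n * \<delta> < 1"
  shows "G = {1..n}"
proof -
  have "G \<subseteq> {1..n}" "(1 - \<delta>) * real n \<le> real (card G)"
    using assms by (auto simp: corrupted_sample_def)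
  moreover from this have "real n < real (card G) + 1"
    using assms(2) by (simp add: algebra_simps)
  ultimately show ?thesis by (intro card_seteq) auto
qed

text \<open>Unclipped, the last step alone lands on the mean, from whatever point the earlier ones
  reached.\<close>

lemma msd_no_clipping:
  assumes "1 \<le> n"
  shows "msd M d (\<lambda>\<omega>. centered_clipping d n (\<lambda>_. \<infinity>) v0 (\<lambda>i. x i \<omega>) (Suc K))
    (\<lambda>\<omega>. good_mean d {1..n} (\<lambda>i. x i \<omega>)) = 0"
  using assms by (simp add: msd_def vdist_clip_step_infinity del: One_nat_def)

text \<open>The prescribed number of steps lets the radii start above the initial distance and end
  at twice \<open>\<rho> / sqrt \<delta>\<close>. Halving takes only \<open>1 / ln 2\<close> steps
  per unit of the logarithm, far fewer than 100.\<close>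

lemma scale_reaches_start:
  fixes \<delta> \<rho> B :: real
  assumes "0 < \<delta>" "\<delta> \<le> 1 / 10" "0 < \<rho>" "0 < B"
    and L: "100 * ln (3 * B\<^sup>2 / (\<delta> * \<rho>\<^sup>2)) \<le> real (Suc K)"
  shows "2 * B \<le> \<rho> / sqrt \<delta> * 2 ^ K"
proof -
  define u where "u = B / (\<rho> / sqrt \<delta>)"
  let ?X = "3 * B\<^sup>2 / (\<delta> * \<rho>\<^sup>2)"
  have X0: "0 < ?X" using assms by simp
  have u2: "?X = 3 * u\<^sup>2 / \<delta>\<^sup>2"
    using assms by (simp add: u_def power_divide power_mult_distrib power2_eq_square[of \<delta>])
  \<comment> \<open>The value \<open>3 / 8\<close> is what turns \<open>3 / \<delta>\<^sup>2\<close>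
    into at least 8.\<close>
  have "\<delta>\<^sup>2 \<le> 3 / 8" using power_mono[of \<delta> "1 / 10" 2] assms by (simp add: power2_eq_square)
  then have "8 * u\<^sup>2 * \<delta>\<^sup>2 \<le> 3 * u\<^sup>2"
    using mult_left_mono[of "\<delta>\<^sup>2" "3 / 8" "8 * u\<^sup>2"] by simp
  then have 8: "8 * u\<^sup>2 \<le> ?X" unfolding u2 using assms by (simp add: pos_le_divide_eq)
  have "ln (1 / 2 :: real) \<le> 1 / 2 - 1" by (rule ln_le_minus_one) simp
  then have ln2: "1 / 2 \<le> ln (2 :: real)" by (simp add: ln_div)
  have "ln ?X \<le> real (Suc K) / 100" using L by simp
  also have "\<dots> \<le> real (Suc K) * (1 / 2)" by simp
  also have "\<dots> \<le> real (Suc K) * ln 2" using ln2 by (intro mult_left_mono) auto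
  also have "\<dots> = ln (2 ^ Suc K)" by (simp only: ln_realpow zero_less_numeral)
  finally have X: "?X \<le> 2 ^ Suc K" using X0 by (subst (asm) ln_le_cancel_iff) auto
  \<comment> \<open>\<open>8 * u\<^sup>2\<close> dominates \<open>4 * u\<close> only from
    \<open>u = 1 / 2\<close> on; below that, \<open>2 \<le> 2 ^ Suc K\<close> suffices.\<close>
  have "4 * u \<le> 2 ^ Suc K"
  proof (cases "u \<le> 1 / 2")
    case True
    moreover have "(1::real) \<le> 2 ^ K" by simp
    ultimately show ?thesis by (simp only: power_Suc)
  next
    case False
    then have "4 * u \<le> 8 * u\<^sup>2" by (simp add: power2_eq_square)
    then show ?thesis using 8 X by linarith
  qed
  then have "2 * u \<le> 2 ^ K" by simp
  then show ?thesis using assms unfolding u_def by (simp add: field_simps)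
qed

theorem corollary5:
  fixes n :: nat and \<delta> \<rho> :: real
  assumes "1 \<le> n" and "0 \<le> \<delta>" and "\<delta> \<le> 1 / 10" and "0 \<le> \<rho>"
  shows
    "(\<forall>B::real. 0 < B \<longrightarrow> 0 < \<delta> * \<rho>\<^sup>2 \<longrightarrow>
       (\<exists>\<tau> :: nat \<Rightarrow> ereal. (\<forall>l. 0 < \<tau> l) \<and>
         (\<forall>(d::nat) (M :: 'w measure) x G v0.
            corrupted_sample M d n \<delta> \<rho> G x \<longrightarrow>
            v0 \<in> space (rspace d) \<longrightarrow>
            msd M d (\<lambda>_. v0) (\<lambda>\<omega>. good_mean d G (\<lambda>i. x i \<omega>)) \<le> ennreal (B\<^sup>2) \<longrightarrow>
            msd M d
              (\<lambda>\<omega>. centered_clipping d n \<tau> v0 (\<lambda>i. x i \<omega>)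
                     (nat \<lceil>100 * ln (3 * B\<^sup>2 / (\<delta> * \<rho>\<^sup>2))\<rceil>))
              (\<lambda>\<omega>. good_mean d G (\<lambda>i. x i \<omega>))
              \<le> ennreal (4000 * \<delta> * \<rho>\<^sup>2))))
     \<and>
     (\<exists>\<tau> :: ereal. 0 \<le> \<tau> \<and> (0 < \<rho> \<or> \<delta> = 0 \<longrightarrow> 0 < \<tau>) \<and>
         (\<forall>(d::nat) (M :: 'w measure) x G v0.
            corrupted_sample M d n \<delta> \<rho> G x \<longrightarrow>
            v0 \<in> space (rspace d) \<longrightarrow>
            msd M d (\<lambda>_. v0) (\<lambda>\<omega>. good_mean d G (\<lambda>i. x i \<omega>)) \<le> ennreal (\<rho>\<^sup>2) \<longrightarrow>
            msd M d
              (\<lambda>\<omega>. centered_clipping d n (\<lambda>_. \<tau>) v0 (\<lambda>i. x i \<omega>) 1)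
              (\<lambda>\<omega>. good_mean d G (\<lambda>i. x i \<omega>))
              \<le> ennreal (4000 * \<delta> * \<rho>\<^sup>2)))"
    (is "(\<forall>B. _ \<longrightarrow> _ \<longrightarrow> (\<exists>\<tau>. ?pos \<tau> \<and> ?multi B \<tau>)) \<and> (\<exists>\<tau>. ?nonneg \<tau> \<and> ?pos1 \<tau> \<and> ?single \<tau>)")
proof (intro conjI allI impI)
  fix B :: real assume B: "0 < B" and \<delta>\<rho>: "0 < \<delta> * \<rho>\<^sup>2"
  then have pos: "0 < \<delta>" "0 < \<rho>" using assms by (auto simp: zero_less_mult_iff)
  show "\<exists>\<tau>. ?pos \<tau> \<and> ?multi B \<tau>"
  proof (cases "nat \<lceil>100 * ln (3 * B\<^sup>2 / (\<delta> * \<rho>\<^sup>2))\<rceil>")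
    \<comment> \<open>No step is taken. A vanishing count means
      \<open>3 * B\<^sup>2 \<le> \<delta> * \<rho>\<^sup>2\<close>, so \<open>v0\<close> is good
      enough as it is; the radius 1 is an arbitrary positive value.\<close>
    case 0
    then have "ln (3 * B\<^sup>2 / (\<delta> * \<rho>\<^sup>2)) \<le> 0" by simp
    then have "3 * B\<^sup>2 / (\<delta> * \<rho>\<^sup>2) \<le> 1"
      using B \<delta>\<rho> by (subst (asm) ln_le_zero_iff) auto
    then have "B\<^sup>2 \<le> 4000 * \<delta> * \<rho>\<^sup>2" using \<delta>\<rho> by (simp add: pos_divide_le_eq)
    from ennreal_leI[OF this] have "?multi B (\<lambda>_. 1)"
      unfolding 0 centered_clipping.simps by (intro allI impI) (erule order_trans)
    then show ?thesis by (intro exI[of _ "\<lambda>_. 1"]) auto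
  next
    case (Suc K)
    show ?thesis
    proof (cases "real n * \<delta> < 1")
      case True
      then have "?multi B (\<lambda>_. \<infinity>)"
        unfolding Suc using msd_no_clipping[OF assms(1)] by (metis corrupted_sample_all_good zero_le)
      then show ?thesis by (intro exI[of _ "\<lambda>_. \<infinity>"]) auto
    next
      case False
      have "2 * B \<le> \<rho> / sqrt \<delta> * 2 ^ K"
        using pos(1) assms(3) pos(2) B by (rule scale_reaches_start) (use Suc in linarith)
      then have "?multi B (\<lambda>l. ereal (2 * (\<rho> / sqrt \<delta> * 2 ^ K / 2 ^ l)))"
        unfolding Suc using False pos assms(3) B
        by (intro allI impI msd_centered_clipping_le) auto
      then show ?thesis
        using pos by (intro exI[of _ "\<lambda>l. ereal (2 * (\<rho> / sqrt \<delta> * 2 ^ K / 2 ^ l))"]) simp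
    qed
  qed
next
  show "\<exists>\<tau>. ?nonneg \<tau> \<and> ?pos1 \<tau> \<and> ?single \<tau>"
  proof (cases "real n * \<delta> < 1")
    case True
    then have "?single \<infinity>"
      unfolding One_nat_def using msd_no_clipping[OF assms(1)]
      by (metis corrupted_sample_all_good zero_le)
    then show ?thesis by (intro exI[of _ \<infinity>]) auto
  next
    case False
    then have \<delta>: "0 < \<delta>" using assms(2) by (cases "\<delta> = 0") auto
    show ?thesis
    proof (cases "\<rho> = 0")
      case True
      \<comment> \<open>With \<open>\<rho> = 0\<close> the start has mean squared error 0 and must
        not be moved, which a bad vector could do at any positive radius. At radius 0 the factor is
        0, also at distance 0, since \<open>0 / 0 = 0\<close> in the extended reals.\<close>
      have "vdist d (clip_step d n 0 y v) w = vdist d v w" for d y v w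
        by (rule vdist_cong) (simp_all add: clip_step_def clip_factor_def)
      then have "?single 0" unfolding True One_nat_def by (simp add: msd_def)
      then show ?thesis using True \<delta> by (intro exI[of _ 0]) auto
    next
      case False
      then have \<rho>: "0 < \<rho>" using assms(4) by simp
      \<comment> \<open>This is the case \<open>B = \<rho>\<close>, \<open>K = 0\<close> of the
        general estimate: twice the initial distance already fits below
        \<open>\<rho> / sqrt \<delta>\<close>, because \<open>\<delta> \<le> 1 / 4\<close>.\<close>
      have "sqrt \<delta> \<le> 1 / 2" using assms(3) by (intro real_le_lsqrt) (simp_all add: power2_eq_square)
      then have "2 * \<rho> \<le> \<rho> / sqrt \<delta> * 2 ^ 0" using \<delta> \<rho> by (simp add: field_simps)
      then have "?single (ereal (2 * (\<rho> / sqrt \<delta>)))"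
        using msd_centered_clipping_le[of \<delta> n \<rho> \<rho> _ _ _ _ _ 0] \<open>\<not> real n * \<delta> < 1\<close> \<delta> \<rho> assms(3)
        by auto
      then show ?thesis using \<delta> \<rho> by (intro exI[of _ "ereal (2 * (\<rho> / sqrt \<delta>))"]) simp
    qed
  qed
qed

end
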